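(* Let $p,w\in\mathcal{AP}_+(\mathbb{R},\mathbb{R})$ and $q\in\mathcal{AP}(\mathbb{R},\mathbb{R})$, write $\mathbf{v}=(\frac1p,q,w)$, and let $\lambda\in\mathbb{R}$. For a non-trivial real-valued solution $\phi$ of $$-\big(p(x)\phi'(x)\big)'+q(x)\phi(x)=\lambda w(x)\phi(x),\qquad x\in\mathbb{R},$$ let $\theta_\lambda(x;\mathbf{v})$ be a continuous branch of $\arg\big(p(x)\phi'(x)+\mathrm{i}\,\phi(x)\big)$. Then the limit $$\lim_{x\to+\infty}\frac{\theta_\lambda(x;\mathbf{v})-\theta_\lambda(0;\mathbf{v})}{x}$$ exists and is independent of the choice of the non-trivial solution $\phi$. (This limit is called the rotation number and denoted $\rho(\lambda,\mathbf{v})$.)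
   Context: A continuous $f:\mathbb{R}\to\mathbb{K}$ ($\mathbb{K}=\mathbb{R}$ or $\mathbb{C}$) is Bohr almost periodic if every real sequence has a subsequence $\{t_n\}$ such that the shifts $f\cdot t_n:=f(\cdot+t_n)$ converge uniformly on $\mathbb{R}$; $\mathcal{AP}(\mathbb{R},\mathbb{K})$ is the set of such functions. The hull $\mathrm{E}(f)$ is the closure of $\{f\cdot t:t\in\mathbb{R}\}$ in the uniform norm. $\mathcal{AP}_+(\mathbb{R},\mathbb{R})$ is the set of $f\in\mathcal{AP}(\mathbb{R},\mathbb{R})$ such that every $\widetilde f\in\mathrm{E}(f)$ is positive, i.e. $\widetilde f(x)>0$ for all $x\in\mathbb{R}$. A solution $\phi$ of the differential equation is understood with $\phi$ and $p\phi'$ locally absolutely continuous. *)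

theory Defs
  imports "HOL-Analysis.Analysis"
begin

definition shift :: "(real \<Rightarrow> 'a) \<Rightarrow> real \<Rightarrow> real \<Rightarrow> 'a" where
  "shift f t = (\<lambda>x. f (x + t))"

definition almost_periodic :: "(real \<Rightarrow> 'a::real_normed_vector) \<Rightarrow> bool" where
  "almost_periodic f \<longleftrightarrow>
     continuous_on UNIV f \<and>
     (\<forall>s :: nat \<Rightarrow> real. \<exists>r :: nat \<Rightarrow> nat. strict_mono r \<and>
        (\<exists>g. uniform_limit UNIV (\<lambda>n. shift f (s (r n))) g sequentially))"

text \<open>The closure of the set of all translates of \<open>f\<close> in the uniform norm. For bounded continuous
  \<open>f\<close>, in particular for almost periodic \<open>f\<close>, this is the closure in the type of
  bounded continuous functions; see \<open>ap_hull_eq_closure\<close> below.\<close>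

definition ap_hull :: "(real \<Rightarrow> 'a::real_normed_vector) \<Rightarrow> (real \<Rightarrow> 'a) set" where
  "ap_hull f = {g. \<forall>e>0. \<exists>t. \<forall>x. dist (shift f t x) (g x) < e}"

definition almost_periodic_pos :: "(real \<Rightarrow> real) \<Rightarrow> bool" where
  "almost_periodic_pos f \<longleftrightarrow> almost_periodic f \<and> (\<forall>g \<in> ap_hull f. \<forall>x. g x > 0)"

text \<open>Absolute continuity on every compact interval, in the \<open>\<epsilon>\<close>-\<open>\<delta>\<close> sense. The members of
  a division are finitely many nonempty compact intervals \<open>k = {Inf k..Sup k}\<close> with pairwise
  disjoint interiors; \<open>D division_of \<Union>D\<close> says that \<open>D\<close> is such a family.\<close>

definition locally_abs_cont :: "(real \<Rightarrow> real) \<Rightarrow> bool" where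
  "locally_abs_cont f \<longleftrightarrow>
     (\<forall>a b. \<forall>\<epsilon>>0. \<exists>\<delta>>0. \<forall>D. D division_of \<Union>D \<and> \<Union>D \<subseteq> {a..b} \<and> (\<Sum>k\<in>D. Sup k - Inf k) < \<delta> \<longrightarrow>
        (\<Sum>k\<in>D. \<bar>f (Sup k) - f (Inf k)\<bar>) < \<epsilon>)"

definition p_deriv :: "(real \<Rightarrow> real) \<Rightarrow> (real \<Rightarrow> real) \<Rightarrow> real \<Rightarrow> real" where
  "p_deriv p \<phi> x = p x * deriv \<phi> x"

text \<open>Solutions are understood in the Caratheodory sense: the equation holds almost everywhere. As
  \<open>deriv\<close> is a total function, differentiability is stated explicitly.\<close>

definition sl_solution ::
  "(real \<Rightarrow> real) \<Rightarrow> (real \<Rightarrow> real) \<Rightarrow> (real \<Rightarrow> real) \<Rightarrow> real \<Rightarrow> (real \<Rightarrow> real) \<Rightarrow> bool" where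
  "sl_solution p q w lam \<phi> \<longleftrightarrow>
     locally_abs_cont \<phi> \<and> locally_abs_cont (p_deriv p \<phi>) \<and>
     (AE x in lborel. \<phi> differentiable (at x) \<and> p_deriv p \<phi> differentiable (at x) \<and>
        - deriv (p_deriv p \<phi>) x + q x * \<phi> x = lam * w x * \<phi> x)"

definition is_arg_branch :: "(real \<Rightarrow> complex) \<Rightarrow> (real \<Rightarrow> real) \<Rightarrow> bool" where
  "is_arg_branch z \<theta> \<longleftrightarrow> continuous_on UNIV \<theta> \<and> (\<forall>x. is_Arg (z x) (\<theta> x))"

lemma ap_hull_eq_closure:
  assumes cont: "continuous_on UNIV f" and bdd: "bounded (range f)"
  shows "ap_hull f = apply_bcontfun ` closure (range (\<lambda>t. Bcontfun (shift f t)))"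
proof -
  have sh: "shift f t \<in> bcontfun" for t
  proof -
    have "continuous_on UNIV (shift f t)"
      unfolding shift_def
      by (rule continuous_on_compose2[OF cont]) (auto intro!: continuous_intros)
    moreover have "bounded (range (shift f t))"
      by (rule bounded_subset[OF bdd]) (auto simp: shift_def)
    ultimately show ?thesis by (simp add: bcontfun_def)
  qed
  have ap: "apply_bcontfun (Bcontfun (shift f t)) = shift f t" for t
    using sh by (simp add: Bcontfun_inverse)
  show ?thesis
  proof (intro set_eqI iffI)
    fix g assume g: "g \<in> ap_hull f"
    then have "\<forall>n. \<exists>t. \<forall>x. dist (shift f t x) (g x) < inverse (real (Suc n))"
      unfolding ap_hull_def by simp
    then obtain t where t: "\<And>n x. dist (shift f (t n) x) (g x) < inverse (real (Suc n))"
      by metis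
    have lim: "uniform_limit UNIV (\<lambda>n. shift f (t n)) g sequentially"
    proof (rule uniform_limitI)
      fix e :: real assume "e > 0"
      then obtain N where N: "inverse (real (Suc N)) < e"
        using reals_Archimedean by blast
      show "\<forall>\<^sub>F n in sequentially. \<forall>x\<in>UNIV. dist (shift f (t n) x) (g x) < e"
        unfolding eventually_sequentially
      proof (intro exI[of _ N] allI impI ballI)
        fix n x assume "N \<le> n"
        then have "inverse (real (Suc n)) \<le> inverse (real (Suc N))" by simp
        then show "dist (shift f (t n) x) (g x) < e" using t[of n x] N by linarith
      qed
    qed
    have "g \<in> bcontfun"
      using sh unfolding bcontfun_def
      by (auto intro: uniform_limit_theorem[OF _ lim] uniform_limit_bounded[OF lim])
    then obtain G where G: "g = apply_bcontfun G" by (metis Bcontfun_inverse)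
    have "\<exists>y\<in>range (\<lambda>t. Bcontfun (shift f t)). dist y G < e" if "e > 0" for e
    proof -
      obtain t where t: "\<forall>x. dist (shift f t x) (g x) < e / 2"
        using g \<open>e > 0\<close> unfolding ap_hull_def by (auto dest: spec[of _ "e / 2"])
      have "dist (Bcontfun (shift f t)) G \<le> e / 2"
        by (rule dist_bound) (use t in \<open>auto simp: ap G less_imp_le\<close>)
      then show ?thesis using \<open>e > 0\<close> by (intro bexI[of _ "Bcontfun (shift f t)"]) auto
    qed
    then have "G \<in> closure (range (\<lambda>t. Bcontfun (shift f t)))"
      by (simp add: closure_approachable)
    then show "g \<in> apply_bcontfun ` closure (range (\<lambda>t. Bcontfun (shift f t)))"
      using G by blast
  next
    fix g assume "g \<in> apply_bcontfun ` closure (range (\<lambda>t. Bcontfun (shift f t)))"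
    then obtain G where g: "g = apply_bcontfun G"
      and G: "G \<in> closure (range (\<lambda>t. Bcontfun (shift f t)))" by blast
    show "g \<in> ap_hull f"
      unfolding ap_hull_def
    proof (intro CollectI allI impI)
      fix e :: real assume "e > 0"
      then obtain t where "dist (Bcontfun (shift f t)) G < e"
        using G by (auto simp: closure_approachable)
      then have "dist (shift f t x) (g x) < e" for x
        using dist_fun_lt_imp_dist_val_lt[of "Bcontfun (shift f t)" G e x] by (simp add: ap g)
      then show "\<exists>t. \<forall>x. dist (shift f t x) (g x) < e" by blast
    qed
  qed
qed

end

theory Submission
  imports Defs
begin

text \<open>In polar coordinates the equation becomes
  \<open>\<theta>' = a cos\<^sup>2 \<theta> + b sin\<^sup>2 \<theta>\<close> with \<open>a = 1 / p\<close> and \<open>b = \<lambda> w - q\<close>. The right-hand side is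
  \<open>\<pi>\<close>-periodic in \<open>\<theta>\<close> and solutions are ordered, so two solutions whose coefficients are
  \<open>\<delta>\<close>-close have displacements over time \<open>T\<close> that differ by at most \<open>\<pi> + C(T) \<delta>\<close>; in particular the
  limit does not depend on the solution. By almost periodicity the shifts of \<open>(a, b)\<close> by \<open>s\<close> are
  uniformly close to those by one of finitely many \<open>t\<close>, for all times at once. Cutting \<open>[0, n T]\<close> into
  pieces of length \<open>T\<close>, the displacements over \<open>[s, s + n T]\<close> and \<open>[t, t + n T]\<close> differ by at most
  \<open>n (\<pi> + 1)\<close>, whereas those over \<open>[t, t + n T]\<close> and \<open>[0, n T]\<close> differ by a constant. So for large
  \<open>T\<close> and \<open>n\<close> the mean displacement over \<open>[s, s + n T]\<close> hardly depends on \<open>s\<close>, and the quotients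
  form a Cauchy family.\<close>

section \<open>Absolutely continuous functions\<close>

lemma negligible_outer_open:
  fixes N :: "real set"
  assumes "negligible N" "0 < e"
  obtains U where "open U" "N \<subseteq> U" "U \<in> lmeasurable" "measure lebesgue U < e"
proof -
  have N: "N \<in> null_sets lebesgue" using assms(1) by (simp add: negligible_iff_null_sets)
  obtain U where U: "open U" "N \<subseteq> U" "U - N \<in> lmeasurable" "emeasure lebesgue (U - N) < ennreal e"
    using sets_lebesgue_outer_open[of N e] N assms(2) by blast
  have eq: "U = (U - N) \<union> N" using U by auto
  have "U \<in> lmeasurable"
    using U(3) N eq fmeasurable.Un[of "U - N" lebesgue N] negligible_imp_measurable[OF assms(1)] by auto
  moreover have "measure lebesgue U = measure lebesgue (U - N)"
    using measure_Un_null_set[of "U - N" lebesgue N] U(3) N eq by (auto simp: fmeasurable_def)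
  moreover have "measure lebesgue (U - N) < e"
    using U(3,4) assms(2)
    by (simp add: emeasure_eq_measure2 ennreal_less_iff)
  ultimately show ?thesis using that U by simp
qed

lemma locally_abs_contE:
  assumes "locally_abs_cont f" "0 < e"
  obtains \<delta> where "\<delta> > 0"
    and "\<And>D. D division_of \<Union>D \<Longrightarrow> \<Union>D \<subseteq> {a..b} \<Longrightarrow> (\<Sum>k\<in>D. Sup k - Inf k) < \<delta> \<Longrightarrow>
      (\<Sum>k\<in>D. \<bar>f (Sup k) - f (Inf k)\<bar>) < e"
proof -
  have "\<exists>\<delta>>0. \<forall>D. D division_of \<Union>D \<and> \<Union>D \<subseteq> {a..b} \<and> (\<Sum>k\<in>D. Sup k - Inf k) < \<delta> \<longrightarrow>
      (\<Sum>k\<in>D. \<bar>f (Sup k) - f (Inf k)\<bar>) < e"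
    using assms unfolding locally_abs_cont_def by simp
  then show ?thesis using that by blast
qed

lemma locally_abs_cont_continuous_on:
  assumes "locally_abs_cont f"
  shows "continuous_on UNIV f"
proof -
  have "\<exists>d>0. \<forall>y. dist y x < d \<longrightarrow> dist (f y) (f x) < e" if e: "e > 0" for x e
  proof -
    obtain \<delta> where "\<delta> > 0" and \<delta>:
      "\<And>D. D division_of \<Union>D \<Longrightarrow> \<Union>D \<subseteq> {x-1..x+1} \<Longrightarrow> (\<Sum>k\<in>D. Sup k - Inf k) < \<delta> \<Longrightarrow>
        (\<Sum>k\<in>D. \<bar>f (Sup k) - f (Inf k)\<bar>) < e"
      by (rule locally_abs_contE[OF assms e, of "x-1" "x+1"]) (rule that)
    \<comment> \<open>A division with a single member turns absolute continuity into a bound on one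
      increment.\<close>
    have key: "\<bar>f v - f u\<bar> < e" if "u \<le> v" "{u..v} \<subseteq> {x-1..x+1}" "v - u < \<delta>" for u v
      using \<delta>[of "{{u..v}}"] division_of_self[of u v] that by simp
    show ?thesis
    proof (intro exI[of _ "min 1 \<delta>"] conjI allI impI)
      fix y assume y: "dist y x < min 1 \<delta>"
      show "dist (f y) (f x) < e"
      proof (cases "x \<le> y")
        case True
        then have "{x..y} \<subseteq> {x-1..x+1}" "y - x < \<delta>" using y by (auto simp: dist_real_def)
        then show ?thesis using key[of x y] True by (auto simp: dist_real_def)
      next
        case False
        then have "{y..x} \<subseteq> {x-1..x+1}" "x - y < \<delta>" using y by (auto simp: dist_real_def)
        then show ?thesis using key[of y x] False by (auto simp: dist_real_def)
      qed
    qed (use \<open>\<delta> > 0\<close> in auto)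
  qed
  then show ?thesis by (auto simp: continuous_on_iff)
qed

text \<open>The gauge is contained in an open set of small measure at the exceptional points; the
  subintervals tagged there contribute little to the increment by absolute continuity.\<close>

lemma locally_abs_cont_has_integral:
  fixes f g :: "real \<Rightarrow> real"
  assumes ac: "locally_abs_cont f" and ae: "AE x in lborel. (f has_real_derivative g x) (at x)"
    and "a \<le> b"
  shows "(g has_integral (f b - f a)) {a..b}"
proof -
  obtain N where N: "N \<in> null_sets lborel" and der: "\<And>x. x \<notin> N \<Longrightarrow> (f has_real_derivative g x) (at x)"
    using ae by (auto elim!: AE_E3)
  then have neg: "negligible N"
    by (simp add: negligible_iff_null_sets null_sets_completionI)
  \<comment> \<open>Tags in \<open>N\<close> contribute zero to the Riemann sums of
    \<open>h\<close>, so only the increments of \<open>f\<close> remain to be estimated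
    there.\<close>
  define h where "h = (\<lambda>x. if x \<in> N then 0 else g x)"
  have h: "(h has_integral (f b - f a)) {a..b}"
    unfolding has_integral_real
  proof (intro allI impI)
    fix e :: real assume e: "e > 0"
    \<comment> \<open>Half of \<open>e\<close> is reserved for the tags outside \<open>N\<close>;
      the \<open>+ 1\<close> covers the case \<open>a = b\<close>.\<close>
    define \<eta> where "\<eta> = e / (2 * (b - a + 1))"
    have \<eta>: "\<eta> > 0" using e \<open>a \<le> b\<close> by (simp add: \<eta>_def)
    have "\<exists>d>0. \<forall>y. \<bar>y - x\<bar> < d \<longrightarrow> \<bar>f y - f x - g x * (y - x)\<bar> \<le> \<eta> * \<bar>y - x\<bar>" if "x \<notin> N" for x
    proof -
      have "(f has_derivative (\<lambda>z. g x * z)) (at x within UNIV)"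
        using der[OF that] by (simp add: has_field_derivative_def)
      then show ?thesis
        using \<eta> unfolding has_derivative_within_alt by (auto simp: mult.commute)
    qed
    then obtain d where d: "\<And>x. x \<notin> N \<Longrightarrow> d x > 0"
      and dd: "\<And>x y. x \<notin> N \<Longrightarrow> \<bar>y - x\<bar> < d x \<Longrightarrow> \<bar>f y - f x - g x * (y - x)\<bar> \<le> \<eta> * \<bar>y - x\<bar>"
      by metis
    obtain \<delta> where "\<delta> > 0" and \<delta>:
      "\<And>D. D division_of \<Union>D \<Longrightarrow> \<Union>D \<subseteq> {a..b} \<Longrightarrow> (\<Sum>k\<in>D. Sup k - Inf k) < \<delta> \<Longrightarrow>
        (\<Sum>k\<in>D. \<bar>f (Sup k) - f (Inf k)\<bar>) < e / 2"
      by (rule locally_abs_contE[OF ac half_gt_zero[OF e], of a b]) (rule that)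
    obtain U where U: "open U" "N \<subseteq> U" "U \<in> lmeasurable" "measure lebesgue U < \<delta>"
      using negligible_outer_open[OF neg \<open>\<delta> > 0\<close>] .
    define \<gamma> where "\<gamma> = (\<lambda>x. if x \<in> N then U else ball x (d x))"
    have gauge: "gauge \<gamma>" using U d by (auto simp: gauge_def \<gamma>_def)
    have riemann: "norm ((\<Sum>(x,k)\<in>\<D>. measure lborel k *\<^sub>R h x) - (f b - f a)) < e"
      if \<D>: "\<D> tagged_division_of {a..b}" and fine: "\<gamma> fine \<D>" for \<D>
    proof -
      note D = tagged_division_ofD[OF \<D>]
      define \<N> where "\<N> = {(x,k) \<in> \<D>. x \<in> N}"
      have k: "\<exists>u v. k = {u..v} \<and> u \<le> x \<and> x \<le> v" if "(x,k) \<in> \<D>" for x k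
        using D(2)[OF that] D(4)[OF that] by auto
      have sub: "\<N> \<subseteq> \<D>" by (auto simp: \<N>_def)
      then have part: "\<N> tagged_partial_division_of {a..b}"
        using \<D> tagged_partial_division_subset unfolding tagged_division_of_def by blast
      \<comment> \<open>Two distinct tags of one interval would force its interior to be empty,
        hence the interval to be a point, which has room for only one tag. So sums over tagged pairs
        become sums over intervals.\<close>
      have inj: "inj_on snd \<N>"
      proof (rule inj_onI, clarsimp)
        fix x y k assume xy: "(x,k) \<in> \<N>" "(y,k) \<in> \<N>"
        then obtain u v where uv: "k = {u..v}" "u \<le> x" "x \<le> v" using k sub by blast
        have "y \<in> k" using xy sub D(2) by blast
        show "x = y"
        proof (rule ccontr)
          assume "x \<noteq> y"
          then have "interior k = {}" using D(5)[of x k y k] xy sub by blast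
          then have "\<not> u < v" using uv by (simp add: interior_atLeastAtMost_real)
          then show False using \<open>y \<in> k\<close> uv \<open>x \<noteq> y\<close> by auto
        qed
      qed
      let ?K = "snd ` \<N>"
      have div: "?K division_of \<Union>?K" by (rule partial_division_of_tagged_division[OF part])
      have "\<Union>?K \<subseteq> U" using fine unfolding fine_def \<N>_def \<gamma>_def by fastforce
      have sumeq: "(\<Sum>k\<in>?K. Sup k - Inf k) = (\<Sum>k\<in>?K. measure lebesgue k)"
      proof (rule sum.cong, simp)
        fix k' assume "k' \<in> ?K"
        then obtain x where "(x,k') \<in> \<D>" using sub by auto
        then obtain u v where "k' = {u..v}" "u \<le> v" using k[of x k'] by auto
        then show "Sup k' - Inf k' = measure lebesgue k'" by simp
      qed
      have "(\<Sum>k\<in>?K. Sup k - Inf k) = measure lebesgue (\<Union>?K)"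
        unfolding sumeq by (rule content_division[OF div])
      also have "\<dots> \<le> measure lebesgue U"
        using \<open>\<Union>?K \<subseteq> U\<close> U(3) lmeasurable_division[OF div]
        by (intro measure_mono_fmeasurable) auto
      finally have "(\<Sum>k\<in>?K. Sup k - Inf k) < \<delta>" using U by simp
      moreover have "\<Union>?K \<subseteq> {a..b}"
        by (intro Union_least) (metis imageE prod.collapse tagged_partial_division_ofD(3)[OF part])
      ultimately have "(\<Sum>k\<in>?K. \<bar>f (Sup k) - f (Inf k)\<bar>) < e / 2" using \<delta>[OF div] by simp
      then have smallN: "(\<Sum>(x,k)\<in>\<N>. \<bar>f (Sup k) - f (Inf k)\<bar>) < e / 2"
        by (simp add: sum.reindex[OF inj] case_prod_unfold)
      \<comment> \<open>The tag lies between the endpoints, so the linearization errors on its two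
        sides add up to at most \<open>\<eta>\<close> times the length.\<close>
      have good: "\<bar>measure lborel k * h x - (f (Sup k) - f (Inf k))\<bar> \<le> \<eta> * measure lborel k"
        if xk: "(x,k) \<in> \<D>" and "x \<notin> N" for x k
      proof -
        obtain u v where uv: "k = {u..v}" "u \<le> x" "x \<le> v" using k[OF xk] by blast
        have "k \<subseteq> ball x (d x)" using fineD[OF fine xk] \<open>x \<notin> N\<close> by (simp add: \<gamma>_def)
        moreover have "u \<in> k" "v \<in> k" using uv by auto
        ultimately have "u \<in> ball x (d x)" "v \<in> ball x (d x)" by blast+
        then have "\<bar>u - x\<bar> < d x" "\<bar>v - x\<bar> < d x" by (auto simp: dist_real_def)
        then have "\<bar>f u - f x - g x * (u - x)\<bar> \<le> \<eta> * (x - u)"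
          "\<bar>f v - f x - g x * (v - x)\<bar> \<le> \<eta> * (v - x)"
          using dd[OF \<open>x \<notin> N\<close>, of u] dd[OF \<open>x \<notin> N\<close>, of v] uv by auto
        then show ?thesis using uv \<open>x \<notin> N\<close> by (simp add: h_def algebra_simps abs_le_iff)
      qed
      have "(\<Sum>(x,k)\<in>\<D>. measure lborel k *\<^sub>R h x) - (f b - f a)
          = (\<Sum>(x,k)\<in>\<D>. measure lborel k * h x - (f (Sup k) - f (Inf k)))"
        using additive_tagged_division_1[OF \<open>a \<le> b\<close> \<D>, of f]
        by (simp add: case_prod_unfold sum_subtractf)
      also have "\<bar>\<dots>\<bar> \<le> (\<Sum>(x,k)\<in>\<D>. \<bar>measure lborel k * h x - (f (Sup k) - f (Inf k))\<bar>)"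
        by (simp add: case_prod_unfold)
      also have "\<dots> \<le> (\<Sum>(x,k)\<in>\<D>. \<eta> * measure lborel k + (if x \<in> N then \<bar>f (Sup k) - f (Inf k)\<bar> else 0))"
        using good \<eta> by (intro sum_mono) (auto simp: h_def abs_minus_commute)
      also have "\<dots> = \<eta> * (\<Sum>(x,k)\<in>\<D>. measure lborel k) + (\<Sum>(x,k)\<in>\<N>. \<bar>f (Sup k) - f (Inf k)\<bar>)"
        using D(1) by (simp add: case_prod_unfold sum.distrib sum_distrib_left \<N>_def sum.inter_filter)
      also have "(\<Sum>(x,k)\<in>\<D>. measure lborel k) = b - a"
        using additive_content_tagged_division[of \<D> a b] \<D> \<open>a \<le> b\<close> by simp
      also have "\<eta> * (b - a) \<le> e / 2"
        using e \<open>a \<le> b\<close> by (simp add: \<eta>_def field_simps)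
      finally show ?thesis using smallN by simp
    qed
    show "\<exists>\<gamma>. gauge \<gamma> \<and> (\<forall>\<D>. \<D> tagged_division_of {a..b} \<and> \<gamma> fine \<D> \<longrightarrow>
        norm ((\<Sum>(x,k)\<in>\<D>. measure lborel k *\<^sub>R h x) - (f b - f a)) < e)"
      using gauge riemann by (intro exI[of _ \<gamma>]) simp
  qed
  show ?thesis by (rule has_integral_spike[OF neg _ h]) (simp add: h_def)
qed

text \<open>By the integral formula \<open>f\<close> is, up to a constant, a primitive of the
  continuous function \<open>g\<close>, which upgrades the derivative from almost every point to
  every point. Starting the integral at \<open>x - 1\<close> keeps \<open>x\<close> in the
  interior.\<close>

lemma locally_abs_cont_has_real_derivative:
  fixes f g :: "real \<Rightarrow> real"
  assumes ac: "locally_abs_cont f" and ae: "AE x in lborel. (f has_real_derivative g x) (at x)"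
    and cont: "continuous_on UNIV g"
  shows "(f has_real_derivative g x) (at x)"
proof -
  have cont': "continuous_on {x-1..x+1} g" using cont continuous_on_subset by blast
  have "((\<lambda>y. integral {x-1..y} g) has_real_derivative g x) (at x within {x-1..x+1})"
    by (rule integral_has_real_derivative[OF cont']) simp
  then have "((\<lambda>y. integral {x-1..y} g) has_real_derivative g x) (at x)"
    by (subst (asm) at_within_Icc_at) auto
  then have "((\<lambda>y. integral {x-1..y} g + f (x-1)) has_real_derivative g x) (at x)"
    by (auto intro!: derivative_eq_intros)
  then show ?thesis
  proof (rule DERIV_cong_ev[THEN iffD1, rotated 3])
    have "\<forall>\<^sub>F y in nhds x. x - 1 < y"
      by (rule eventually_nhds_in_open[of "{x-1<..}" x, simplified])
    then show "\<forall>\<^sub>F y in nhds x. integral {x-1..y} g + f (x-1) = f y"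
      by eventually_elim (simp add: integral_unique[OF locally_abs_cont_has_integral[OF ac ae]])
  qed auto
qed

section \<open>The angle equation\<close>

text \<open>After the last point \<open>s\<close> with \<open>f s \<le> 0\<close> the function is
  positive, hence nonincreasing, so \<open>f b \<le> f s\<close>.\<close>

lemma DERIV_upper_barrier:
  fixes f :: "real \<Rightarrow> real"
  assumes "a \<le> b" and "f a \<le> 0"
    and der: "\<And>x. a \<le> x \<Longrightarrow> x \<le> b \<Longrightarrow> (f has_real_derivative f' x) (at x)"
    and neg: "\<And>x. a \<le> x \<Longrightarrow> x \<le> b \<Longrightarrow> f x > 0 \<Longrightarrow> f' x \<le> 0"
  shows "f b \<le> 0"
proof (rule ccontr)
  assume "\<not> f b \<le> 0"
  have cont: "continuous_on {a..b} f"
    by (intro continuous_at_imp_continuous_on ballI) (use der DERIV_isCont in auto)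
  define S where "S = {x \<in> {a..b}. f x \<le> 0}"
  have "bounded S" by (rule bounded_subset[of "{a..b}"]) (auto simp: S_def)
  moreover have "closed S"
    using continuous_closed_preimage[OF cont, of "{..0}"] by (auto simp: S_def vimage_def Int_def)
  ultimately have "compact S" by (simp add: compact_eq_bounded_closed)
  moreover have "S \<noteq> {}" using assms by (auto simp: S_def)
  ultimately obtain s where s: "s \<in> S" "\<And>x. x \<in> S \<Longrightarrow> x \<le> s" using compact_attains_sup by metis
  have "f b \<le> f s"
  proof (rule DERIV_nonpos_imp_decreasing_open[where f=f])
    show "s \<le> b" using s by (auto simp: S_def)
    show "\<exists>y. DERIV f x :> y \<and> y \<le> 0" if "s < x" "x < b" for x
    proof -
      have "f x > 0" using s(2)[of x] that s(1) by (force simp: S_def)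
      then show ?thesis using der[of x] neg[of x] that s(1) by (auto simp: S_def)
    qed
    show "continuous_on {s..b} f" using cont s(1) by (auto simp: S_def intro: continuous_on_subset)
  qed
  then show False using s(1) \<open>\<not> f b \<le> 0\<close> by (auto simp: S_def)
qed

definition angle_solution :: "(real \<Rightarrow> real) \<Rightarrow> (real \<Rightarrow> real) \<Rightarrow> (real \<Rightarrow> real) \<Rightarrow> bool" where
  "angle_solution a b \<theta> \<longleftrightarrow>
     (\<forall>x. (\<theta> has_real_derivative a x * (cos (\<theta> x))\<^sup>2 + b x * (sin (\<theta> x))\<^sup>2) (at x))"

lemma angle_solution_shift:
  assumes "angle_solution a b \<theta>"
  shows "angle_solution (shift a t) (shift b t) (shift \<theta> t)"
  using assms unfolding angle_solution_def shift_def
  by (auto intro: DERIV_shift[THEN iffD1])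

lemma angle_solution_add_pi:
  assumes "angle_solution a b \<theta>"
  shows "angle_solution a b (\<lambda>x. \<theta> x + real_of_int k * pi)"
proof -
  have "(cos (y + real_of_int k * pi))\<^sup>2 = (cos y)\<^sup>2 \<and> (sin (y + real_of_int k * pi))\<^sup>2 = (sin y)\<^sup>2" for y
  proof -
    have "sin (real_of_int k * pi) = 0" using sin_zero_iff_int2 by blast
    moreover from this have "(cos (real_of_int k * pi))\<^sup>2 = 1" by (simp add: cos_squared_eq)
    ultimately show ?thesis by (simp add: cos_add sin_add power_mult_distrib)
  qed
  with assms show ?thesis
    unfolding angle_solution_def by (auto intro!: derivative_eq_intros)
qed

text \<open>The field equals \<open>a + (b - a) * sin\<^sup>2\<close>, where
  \<open>\<bar>b - a\<bar> \<le> 2 * K\<close> and the squared sine is Lipschitz with constant 2.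
  Changing the coefficients costs \<open>\<delta>\<close>, as the weights of \<open>a\<close> and
  \<open>b\<close> sum to 1.\<close>

lemma angle_field_diff_le:
  fixes x y a b a' b' :: real
  assumes "\<bar>a\<bar> \<le> K" "\<bar>b\<bar> \<le> K" "\<bar>a - a'\<bar> \<le> \<delta>" "\<bar>b - b'\<bar> \<le> \<delta>"
  shows "a * (cos x)\<^sup>2 + b * (sin x)\<^sup>2 - (a' * (cos y)\<^sup>2 + b' * (sin y)\<^sup>2) \<le> 4 * K * \<bar>x - y\<bar> + \<delta>"
proof -
  have sinle: "\<bar>(sin x)\<^sup>2 - (sin y)\<^sup>2\<bar> \<le> 2 * \<bar>x - y\<bar>"
  proof -
    have "\<bar>sin x - sin y\<bar> \<le> \<bar>x - y\<bar>"
    proof -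
      have "\<bar>sin x - sin y\<bar> = 2 * \<bar>sin ((x - y) / 2)\<bar> * \<bar>cos ((x + y) / 2)\<bar>"
        by (simp add: sin_diff_sin abs_mult)
      also have "\<dots> \<le> 2 * \<bar>(x - y) / 2\<bar> * 1"
        by (intro mult_mono abs_sin_x_le_abs_x) auto
      finally show ?thesis by simp
    qed
    moreover have "\<bar>sin x + sin y\<bar> \<le> 2"
      using abs_sin_le_one[of x] abs_sin_le_one[of y] by linarith
    ultimately have "\<bar>sin x + sin y\<bar> * \<bar>sin x - sin y\<bar> \<le> 2 * \<bar>x - y\<bar>"
      by (intro mult_mono) auto
    then show ?thesis by (simp add: power2_eq_square square_diff_square_factored abs_mult)
  qed
  have "a * (cos x)\<^sup>2 + b * (sin x)\<^sup>2 - (a' * (cos y)\<^sup>2 + b' * (sin y)\<^sup>2)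
      = (b - a) * ((sin x)\<^sup>2 - (sin y)\<^sup>2) + ((a - a') * (cos y)\<^sup>2 + (b - b') * (sin y)\<^sup>2)"
    by (simp add: cos_squared_eq algebra_simps)
  also have "\<dots> \<le> (2 * K) * (2 * \<bar>x - y\<bar>) + (\<delta> * (cos y)\<^sup>2 + \<delta> * (sin y)\<^sup>2)"
  proof (intro add_mono)
    have "(b - a) * ((sin x)\<^sup>2 - (sin y)\<^sup>2) \<le> \<bar>b - a\<bar> * \<bar>(sin x)\<^sup>2 - (sin y)\<^sup>2\<bar>"
      by (metis abs_ge_self abs_mult)
    also have "\<dots> \<le> (2 * K) * (2 * \<bar>x - y\<bar>)"
      using assms sinle by (intro mult_mono) auto
    finally show "(b - a) * ((sin x)\<^sup>2 - (sin y)\<^sup>2) \<le> (2 * K) * (2 * \<bar>x - y\<bar>)" .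
  qed (use assms in \<open>auto intro!: mult_right_mono\<close>)
  also have "\<delta> * (cos y)\<^sup>2 + \<delta> * (sin y)\<^sup>2 = \<delta>"
    by (metis distrib_left mult.right_neutral sin_cos_squared_add2)
  finally show ?thesis by simp
qed

text \<open>A one-sided Gronwall estimate: the difference \<open>u\<close> of the solutions
  satisfies \<open>u' \<le> 4 * K * u + \<delta>\<close> wherever it is positive, so
  \<open>u * exp (- (4 * K * x)) - \<delta> * x\<close> cannot cross zero upwards.\<close>

lemma angle_solution_le:
  assumes 1: "angle_solution a b \<theta>" and 2: "angle_solution a' b' \<theta>'"
    and K: "\<And>x. \<bar>a x\<bar> \<le> K" "\<And>x. \<bar>b x\<bar> \<le> K"
    and \<delta>: "\<And>x. \<bar>a x - a' x\<bar> \<le> \<delta>" "\<And>x. \<bar>b x - b' x\<bar> \<le> \<delta>"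
    and "\<theta> 0 \<le> \<theta>' 0" "0 \<le> T"
  shows "\<theta> T \<le> \<theta>' T + \<delta> * T * exp (4 * K * T)"
proof -
  define u where "u x = \<theta> x - \<theta>' x" for x
  define u' where "u' x = a x * (cos (\<theta> x))\<^sup>2 + b x * (sin (\<theta> x))\<^sup>2
      - (a' x * (cos (\<theta>' x))\<^sup>2 + b' x * (sin (\<theta>' x))\<^sup>2)" for x
  have u: "(u has_real_derivative u' x) (at x)" for x
    using 1 2 unfolding u_def u'_def angle_solution_def by (auto intro!: derivative_eq_intros)
  have "K \<ge> 0" "\<delta> \<ge> 0" using K(1)[of 0] \<delta>(1)[of 0] by linarith+
  have "u T * exp (- (4 * K * T)) - \<delta> * T \<le> 0"
  proof (rule DERIV_upper_barrier[where a=0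
        and f="\<lambda>x. u x * exp (- (4 * K * x)) - \<delta> * x"
        and f'="\<lambda>x. (u' x - 4 * K * u x) * exp (- (4 * K * x)) - \<delta>"])
    fix x assume x: "0 \<le> x" "x \<le> T"
    show "((\<lambda>x. u x * exp (- (4 * K * x)) - \<delta> * x) has_real_derivative
        (u' x - 4 * K * u x) * exp (- (4 * K * x)) - \<delta>) (at x)"
      by (auto intro!: derivative_eq_intros u simp: algebra_simps)
    assume "u x * exp (- (4 * K * x)) - \<delta> * x > 0"
    then have "u x * exp (- (4 * K * x)) > 0" using \<open>\<delta> \<ge> 0\<close> x
      by (smt (verit) mult_nonneg_nonneg)
    then have "u x > 0" by (simp add: zero_less_mult_iff)
    then have "u' x - 4 * K * u x \<le> \<delta>"
      using angle_field_diff_le[OF K(1)[of x] K(2)[of x] \<delta>(1)[of x] \<delta>(2)[of x], of "\<theta> x" "\<theta>' x"]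
      by (simp add: u_def u'_def)
    then have "(u' x - 4 * K * u x) * exp (- (4 * K * x)) \<le> \<delta> * exp (- (4 * K * x))"
      by (rule mult_right_mono) simp
    also have "\<dots> \<le> \<delta> * 1"
      using \<open>K \<ge> 0\<close> \<open>\<delta> \<ge> 0\<close> x by (intro mult_left_mono) auto
    finally show "(u' x - 4 * K * u x) * exp (- (4 * K * x)) - \<delta> \<le> 0" by simp
  qed (use assms in \<open>auto simp: u_def\<close>)
  then have "u T * exp (- (4 * K * T)) * exp (4 * K * T) \<le> \<delta> * T * exp (4 * K * T)"
    by (intro mult_right_mono) auto
  then show ?thesis by (simp add: u_def mult.assoc flip: exp_add)
qed

text \<open>Adding a multiple of \<open>pi\<close> to one solution, the initial angles may be assumed to lie
  within \<open>pi\<close> of each other, and order is preserved up to the error in \<open>angle_solution_le\<close>.\<close>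

lemma angle_solution_displacement:
  assumes 1: "angle_solution a b \<theta>" and 2: "angle_solution a' b' \<theta>'"
    and K: "\<And>x. \<bar>a x\<bar> \<le> K" "\<And>x. \<bar>b x\<bar> \<le> K" "\<And>x. \<bar>a' x\<bar> \<le> K" "\<And>x. \<bar>b' x\<bar> \<le> K"
    and \<delta>: "\<And>x. \<bar>a x - a' x\<bar> \<le> \<delta>" "\<And>x. \<bar>b x - b' x\<bar> \<le> \<delta>"
    and T: "0 \<le> T"
  shows "\<bar>(\<theta> T - \<theta> 0) - (\<theta>' T - \<theta>' 0)\<bar> \<le> pi + \<delta> * T * exp (4 * K * T)"
proof -
  \<comment> \<open>With this \<open>k\<close> the shifted angle \<open>\<phi> 0\<close> lies in the
    interval from \<open>\<theta> 0\<close> to \<open>\<theta> 0 + pi\<close>, so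
    \<open>\<phi>\<close> is squeezed between \<open>\<theta>\<close> and
    \<open>\<theta> + pi\<close> up to the error term.\<close>
  define k where "k = \<lceil>(\<theta> 0 - \<theta>' 0) / pi\<rceil>"
  define \<phi> where "\<phi> = (\<lambda>x. \<theta>' x + real_of_int k * pi)"
  have k: "real_of_int k - 1 < (\<theta> 0 - \<theta>' 0) / pi" "(\<theta> 0 - \<theta>' 0) / pi \<le> real_of_int k"
    unfolding k_def by linarith+
  have k1: "\<theta> 0 - \<theta>' 0 \<le> real_of_int k * pi" and k2: "(real_of_int k - 1) * pi < \<theta> 0 - \<theta>' 0"
    using k by (auto simp: field_simps)
  have \<phi>: "angle_solution a' b' \<phi>" unfolding \<phi>_def by (rule angle_solution_add_pi[OF 2])
  have \<theta>: "angle_solution a b (\<lambda>x. \<theta> x + real_of_int 1 * pi)" by (rule angle_solution_add_pi[OF 1])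
  have "\<theta> T \<le> \<phi> T + \<delta> * T * exp (4 * K * T)"
    by (rule angle_solution_le[OF 1 \<phi>]) (use K \<delta> T k1 in \<open>auto simp: \<phi>_def\<close>)
  moreover have "\<phi> T \<le> (\<theta> T + real_of_int 1 * pi) + \<delta> * T * exp (4 * K * T)"
    by (rule angle_solution_le[OF \<phi> \<theta>])
       (use K \<delta> T k2 in \<open>auto simp: \<phi>_def abs_minus_commute algebra_simps\<close>)
  ultimately show ?thesis using k1 k2 by (auto simp: \<phi>_def algebra_simps abs_le_iff)
qed

text \<open>The derivative is a weighted mean of \<open>a\<close> and \<open>b\<close>, hence
  bounded by \<open>K\<close>.\<close>

lemma angle_solution_lipschitz:
  assumes "angle_solution a b \<theta>" and K: "\<And>x. \<bar>a x\<bar> \<le> K" "\<And>x. \<bar>b x\<bar> \<le> K"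
  shows "\<bar>\<theta> x - \<theta> y\<bar> \<le> K * \<bar>x - y\<bar>"
proof -
  have "norm (\<theta> x - \<theta> y) \<le> K * norm (x - y)"
  proof (rule field_differentiable_bound[where S=UNIV])
    fix z :: real
    show "(\<theta> has_field_derivative a z * (cos (\<theta> z))\<^sup>2 + b z * (sin (\<theta> z))\<^sup>2) (at z within UNIV)"
      using assms(1) by (simp add: angle_solution_def)
    have "\<bar>a z * (cos (\<theta> z))\<^sup>2 + b z * (sin (\<theta> z))\<^sup>2\<bar> \<le> \<bar>a z\<bar> * (cos (\<theta> z))\<^sup>2 + \<bar>b z\<bar> * (sin (\<theta> z))\<^sup>2"
      by (rule order_trans[OF abs_triangle_ineq]) (simp add: abs_mult)
    also have "\<dots> \<le> K * (cos (\<theta> z))\<^sup>2 + K * (sin (\<theta> z))\<^sup>2"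
      using K by (intro add_mono mult_right_mono) auto
    also have "\<dots> = K"
      by (metis distrib_left mult.right_neutral sin_cos_squared_add2)
    finally show "norm (a z * (cos (\<theta> z))\<^sup>2 + b z * (sin (\<theta> z))\<^sup>2) \<le> K" by simp
  qed auto
  then show ?thesis by simp
qed

section \<open>Precompact shifts and the rotation number\<close>

definition precompact_shifts :: "(real \<Rightarrow> 'a::metric_space) \<Rightarrow> bool" where
  "precompact_shifts f \<longleftrightarrow>
     (\<forall>e>0. \<exists>S. finite S \<and> (\<forall>s. \<exists>t\<in>S. \<forall>x. dist (f (x + s)) (f (x + t)) < e))"

lemma almost_periodicE:
  fixes s :: "nat \<Rightarrow> real"
  assumes "almost_periodic f"
  obtains r :: "nat \<Rightarrow> nat" and g
  where "strict_mono r" "uniform_limit UNIV (\<lambda>n. shift f (s (r n))) g sequentially"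
proof -
  have "\<forall>s :: nat \<Rightarrow> real. \<exists>r :: nat \<Rightarrow> nat. strict_mono r \<and>
      (\<exists>g. uniform_limit UNIV (\<lambda>n. shift f (s (r n))) g sequentially)"
    using assms by (simp add: almost_periodic_def)
  from this[rule_format, of s] show ?thesis using that by auto
qed

text \<open>Without a finite cover one can choose inductively a sequence of translates with mutual
  uniform distances at least \<open>e\<close>, and no subsequence of it converges uniformly.\<close>

lemma almost_periodic_imp_precompact_shifts:
  assumes "almost_periodic f"
  shows "precompact_shifts f"
  unfolding precompact_shifts_def
proof (intro allI impI, rule ccontr)
  fix e :: real
  assume e: "e > 0" and no: "\<nexists>S. finite S \<and> (\<forall>s. \<exists>t\<in>S. \<forall>x. dist (f (x + s)) (f (x + t)) < e)"
  have "\<exists>s :: nat \<Rightarrow> real. \<forall>n. \<forall>m<n. \<exists>x. \<not> dist (f (x + s n)) (f (x + s m)) < e"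
  proof (rule dependent_wellorder_choice)
    fix n :: nat and s :: "nat \<Rightarrow> real"
    have "\<not> (\<forall>r. \<exists>t\<in>s ` {..<n}. \<forall>x. dist (f (x + r)) (f (x + t)) < e)"
      using no by (metis finite_imageI finite_lessThan)
    then show "\<exists>r. \<forall>m<n. \<exists>x. \<not> dist (f (x + r)) (f (x + s m)) < e" by auto
  qed simp
  then obtain s :: "nat \<Rightarrow> real" where s: "\<And>n m. m < n \<Longrightarrow> \<exists>x. \<not> dist (f (x + s n)) (f (x + s m)) < e" by blast
  obtain r :: "nat \<Rightarrow> nat" and g where r: "strict_mono r"
    and g: "uniform_limit UNIV (\<lambda>n. shift f (s (r n))) g sequentially"
    by (rule almost_periodicE[OF assms, of s]) (rule that)
  have "\<forall>\<^sub>F n in sequentially. \<forall>x\<in>UNIV. dist (shift f (s (r n)) x) (g x) < e / 2"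
    using e by (intro uniform_limitD[OF g]) auto
  then obtain n where n: "\<And>k x. k \<ge> n \<Longrightarrow> dist (f (x + s (r k))) (g x) < e / 2"
    unfolding eventually_sequentially shift_def by auto
  have "dist (f (x + s (r (Suc n)))) (f (x + s (r n))) < e" for x
    using n[of "Suc n" x] n[of n x]
      dist_triangle2[of "f (x + s (r (Suc n)))" "f (x + s (r n))" "g x"] by simp
  moreover have "r n < r (Suc n)" using r by (simp add: strict_mono_Suc_iff)
  ultimately show False using s by blast
qed

text \<open>Uniform continuity is asked for on the range only, so that the reciprocal may be applied
  to a function bounded away from zero.\<close>

lemma precompact_shifts_compose:
  assumes "precompact_shifts f" "uniformly_continuous_on (range f) h"
  shows "precompact_shifts (\<lambda>x. h (f x))"
  unfolding precompact_shifts_def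
proof (intro allI impI)
  fix e :: real assume "e > 0"
  then obtain d where d: "d > 0" "\<And>x y. dist (f x) (f y) < d \<Longrightarrow> dist (h (f x)) (h (f y)) < e"
    using assms(2) unfolding uniformly_continuous_on_def by (metis rangeI)
  obtain S where "finite S" "\<forall>s. \<exists>t\<in>S. \<forall>x. dist (f (x + s)) (f (x + t)) < d"
    using assms(1) d(1) unfolding precompact_shifts_def by blast
  then show "\<exists>S. finite S \<and> (\<forall>s. \<exists>t\<in>S. \<forall>x. dist (h (f (x + s))) (h (f (x + t))) < e)"
    using d(2) by meson
qed

text \<open>Shifts falling into the same pair of cells of the two finite covers are represented by a
  common one of them.\<close>

lemma precompact_shifts_Pair:
  assumes f: "precompact_shifts f" and g: "precompact_shifts g"
  shows "precompact_shifts (\<lambda>x. (f x, g x))"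
  unfolding precompact_shifts_def
proof (intro allI impI)
  fix e :: real assume "e > 0"
  \<comment> \<open>Two distances of \<open>e / 4\<close> make \<open>e / 2\<close> per coordinate,
    and the product distance is at most the sum.\<close>
  then have "e / 4 > 0" by simp
  obtain S where S: "finite S" "\<forall>s. \<exists>t\<in>S. \<forall>x. dist (f (x + s)) (f (x + t)) < e / 4"
    using f \<open>e / 4 > 0\<close> unfolding precompact_shifts_def by blast
  obtain S' where S': "finite S'" "\<forall>s. \<exists>t\<in>S'. \<forall>x. dist (g (x + s)) (g (x + t)) < e / 4"
    using g \<open>e / 4 > 0\<close> unfolding precompact_shifts_def by blast
  obtain \<sigma> where \<sigma>: "\<And>s. \<sigma> s \<in> S" "\<And>s x. dist (f (x + s)) (f (x + \<sigma> s)) < e / 4"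
    using S(2) by metis
  obtain \<tau> where \<tau>: "\<And>s. \<tau> s \<in> S'" "\<And>s x. dist (g (x + s)) (g (x + \<tau> s)) < e / 4"
    using S'(2) by metis
  let ?c = "\<lambda>s. (\<sigma> s, \<tau> s)"
  have "finite (range ?c)"
    by (rule finite_subset[of _ "S \<times> S'"]) (use \<sigma> \<tau> S S' in auto)
  \<comment> \<open>\<open>inv ?c\<close> picks one shift from each nonempty cell.\<close>
  moreover have "\<exists>t\<in>inv ?c ` range ?c. \<forall>x. dist (f (x + s), g (x + s)) (f (x + t), g (x + t)) < e" for s
  proof -
    have "?c (inv ?c (?c s)) = ?c s" by (rule f_inv_into_f) simp
    then obtain t where t: "t \<in> inv ?c ` range ?c" and eq: "\<sigma> t = \<sigma> s" "\<tau> t = \<tau> s" by blast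
    have "dist (f (x + s), g (x + s)) (f (x + t), g (x + t)) < e" for x
    proof -
      have "dist (f (x + s)) (f (x + t)) < e / 2"
        using \<sigma>(2)[of x s] \<sigma>(2)[of x t] dist_triangle2[of "f (x + s)" "f (x + t)" "f (x + \<sigma> s)"]
        unfolding eq by linarith
      moreover have "dist (g (x + s)) (g (x + t)) < e / 2"
        using \<tau>(2)[of x s] \<tau>(2)[of x t] dist_triangle2[of "g (x + s)" "g (x + t)" "g (x + \<tau> s)"]
        unfolding eq by linarith
      moreover have "dist (f (x + s), g (x + s)) (f (x + t), g (x + t))
          \<le> dist (f (x + s)) (f (x + t)) + dist (g (x + s)) (g (x + t))"
        by (simp add: dist_Pair_Pair sqrt_sum_squares_le_sum)
      ultimately show ?thesis by linarith
    qed
    with t show ?thesis by blast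
  qed
  ultimately show "\<exists>S. finite S \<and> (\<forall>s. \<exists>t\<in>S. \<forall>x. dist (f (x + s), g (x + s)) (f (x + t), g (x + t)) < e)"
    by (intro exI[of _ "inv ?c ` range ?c"]) simp
qed

text \<open>Evaluating the shifts at 0 puts every value within distance 1 of one of finitely
  many.\<close>

lemma precompact_shifts_bounded:
  assumes "precompact_shifts f"
  shows "bounded (range f)"
proof -
  obtain S where S: "finite S" "\<And>s. \<exists>t\<in>S. \<forall>x. dist (f (x + s)) (f (x + t)) < 1"
    using assms unfolding precompact_shifts_def by (meson zero_less_one)
  have "f s \<in> (\<Union>t\<in>S. ball (f t) 1)" for s
    using S(2)[of s] by (force simp: dist_commute dest: spec[of _ 0])
  then have "range f \<subseteq> (\<Union>t\<in>S. ball (f t) 1)" by blast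
  then show ?thesis using S(1) by (meson bounded_UN bounded_ball bounded_subset)
qed

text \<open>If \<open>f\<close> came arbitrarily close to zero or below along \<open>s n\<close>, a
  uniform limit of the corresponding shifts would be a member of the hull that is not positive at
  0.\<close>

lemma almost_periodic_pos_lower_bound:
  assumes "almost_periodic_pos f"
  obtains m where "m > 0" "\<And>x. m \<le> f x"
proof (rule ccontr)
  assume "\<not> thesis"
  then have *: "\<exists>t. f t < inverse (real (Suc n))" for n
    using that[of "inverse (real (Suc n))"] by (force simp: not_le)
  have ap: "almost_periodic f" using assms by (simp add: almost_periodic_pos_def)
  from * obtain s :: "nat \<Rightarrow> real" where s: "\<And>n. f (s n) < inverse (real (Suc n))" by metis
  obtain r :: "nat \<Rightarrow> nat" and g where r: "strict_mono r"
    and g: "uniform_limit UNIV (\<lambda>n. shift f (s (r n))) g sequentially"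
    by (rule almost_periodicE[OF ap, of s]) (rule that)
  have "g \<in> ap_hull f"
    unfolding ap_hull_def
  proof (intro CollectI allI impI)
    fix e :: real assume "e > 0"
    from uniform_limitD[OF g this] show "\<exists>t. \<forall>x. dist (shift f t x) (g x) < e"
      by (auto dest!: eventually_happens)
  qed
  then have "g 0 > 0" using assms by (simp add: almost_periodic_pos_def)
  have "(\<lambda>n. shift f (s (r n)) 0) \<longlonglongrightarrow> g 0"
    by (rule tendsto_uniform_limitI[OF g]) simp
  then have "(\<lambda>n. f (s (r n))) \<longlonglongrightarrow> g 0" by (simp add: shift_def)
  moreover have "f (s (r n)) \<le> inverse (real (Suc n))" for n
    using s[of "r n"] seq_suble[OF r, of n]
    by (smt (verit, ccfv_threshold) le_imp_inverse_le of_nat_0_less_iff of_nat_le_iff Suc_le_mono zero_less_Suc)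
  ultimately have "g 0 \<le> 0"
    by (intro LIMSEQ_le[OF _ LIMSEQ_inverse_real_of_nat]) auto
  then show False using \<open>g 0 > 0\<close> by simp
qed

section \<open>Convergence of the mean displacement\<close>

lemma convergent_filterI:
  fixes f :: "'b \<Rightarrow> real"
  assumes "F \<noteq> bot" and *: "\<And>e. e > 0 \<Longrightarrow> \<exists>c. \<forall>\<^sub>F x in F. \<bar>f x - c\<bar> \<le> e"
  shows "\<exists>l. (f \<longlongrightarrow> l) F"
proof -
  have "cauchy_filter (filtermap f F)"
    unfolding cauchy_filter_metric_filtermap
  proof (intro allI impI)
    fix e :: real assume "e > 0"
    then obtain c where c: "\<forall>\<^sub>F x in F. \<bar>f x - c\<bar> \<le> e / 3" using *[of "e / 3"] by auto
    have "dist (f x) (f y) < e" if "\<bar>f x - c\<bar> \<le> e / 3" "\<bar>f y - c\<bar> \<le> e / 3" for x y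
      using that \<open>e > 0\<close> unfolding dist_real_def by linarith
    with c show "\<exists>P. eventually P F \<and> (\<forall>x y. P x \<and> P y \<longrightarrow> dist (f x) (f y) < e)"
      by (intro exI[of _ "\<lambda>x. \<bar>f x - c\<bar> \<le> e / 3"]) simp
  qed
  then show ?thesis
    using cauchy_filter_complete_converges[OF _ complete_UNIV] assms(1)
    unfolding filterlim_def by (metis filtermap_bot_iff top_greatest principal_UNIV)
qed

text \<open>The start \<open>s\<close> is first replaced by a representative \<open>t\<close>, block
  by block; then the interval starting at \<open>t\<close> is compared with the one starting at 0,
  which differs from it only near the ends. The error per block does not grow with the block length,
  so long blocks make it relatively small.\<close>

lemma angle_solution_uniform_displacement:
  assumes sol: "angle_solution a b \<theta>" and K: "\<And>x. \<bar>a x\<bar> \<le> K" "\<And>x. \<bar>b x\<bar> \<le> K"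
    and pre: "precompact_shifts (\<lambda>x. (a x, b x))" and "e > 0"
  obtains L where "L > 0" "\<And>s. \<bar>(\<theta> (s + L) - \<theta> s) - (\<theta> L - \<theta> 0)\<bar> \<le> e * L"
proof -
  have "K \<ge> 0" using K(1)[of 0] by linarith
  \<comment> \<open>The \<open>n\<close> blocks will cost at most \<open>5 * n\<close>, while the
    allowance \<open>e * (n * T)\<close> becomes \<open>6 * n\<close>.\<close>
  define T where "T = 6 / e"
  have T: "T > 0" using \<open>e > 0\<close> by (simp add: T_def)
  \<comment> \<open>This makes the perturbation term in \<open>angle_solution_displacement\<close>
    equal to 1, so a block costs at most \<open>pi + 1 < 5\<close>.\<close>
  define \<delta> where "\<delta> = 1 / (T * exp (4 * K * T))"
  have "\<delta> > 0" using T by (simp add: \<delta>_def)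
  then obtain S where S: "finite S" and
    close: "\<And>s. \<exists>t\<in>S. \<forall>x. dist (a (x + s), b (x + s)) (a (x + t), b (x + t)) < \<delta>"
    using pre unfolding precompact_shifts_def by meson
  obtain B where B: "\<And>t. t \<in> S \<Longrightarrow> \<bar>t\<bar> \<le> B"
    using finite_imp_bounded[OF S] by (auto simp: bounded_iff)
  \<comment> \<open>Moving from \<open>t\<close> to 0 costs at most \<open>2 * K * B\<close> in
    total, which the spare allowance \<open>n\<close> absorbs; \<open>Suc\<close> keeps the length
    positive.\<close>
  define n where "n = Suc (nat \<lceil>2 * K * B\<rceil>)"
  have n: "2 * K * B \<le> real n" "n > 0" unfolding n_def by linarith+
  have "\<bar>(\<theta> (s + real n * T) - \<theta> s) - (\<theta> (real n * T) - \<theta> 0)\<bar> \<le> e * (real n * T)" for s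
  proof -
    obtain t where "t \<in> S" and t: "\<And>x. dist (a (x + s), b (x + s)) (a (x + t), b (x + t)) < \<delta>"
      using close by blast
    have ab: "\<bar>a (x + s) - a (x + t)\<bar> \<le> \<delta>" "\<bar>b (x + s) - b (x + t)\<bar> \<le> \<delta>" for x
      using t[of x] dist_fst_le[of "(a (x + s), b (x + s))" "(a (x + t), b (x + t))"]
        dist_snd_le[of "(a (x + s), b (x + s))" "(a (x + t), b (x + t))"]
      by (auto simp: dist_real_def)
    \<comment> \<open>The coefficients shifted by \<open>s\<close> and by \<open>t\<close> are close
      at all times, so the same \<open>t\<close> serves for every offset \<open>r\<close>.\<close>
    have step: "\<bar>(\<theta> (s + r + T) - \<theta> (s + r)) - (\<theta> (t + r + T) - \<theta> (t + r))\<bar> \<le> 5" for r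
    proof -
      have "\<bar>(shift \<theta> (s + r) T - shift \<theta> (s + r) 0) - (shift \<theta> (t + r) T - shift \<theta> (t + r) 0)\<bar>
          \<le> pi + \<delta> * T * exp (4 * K * T)"
        using ab[of "x + r" for x] K T
        by (intro angle_solution_displacement[OF angle_solution_shift[OF sol] angle_solution_shift[OF sol]])
          (auto simp: shift_def algebra_simps)
      also have "\<delta> * T * exp (4 * K * T) = 1" using T by (simp add: \<delta>_def)
      finally show ?thesis using pi_less_4 by (simp add: shift_def algebra_simps)
    qed
    have "\<bar>(\<theta> (s + real k * T) - \<theta> s) - (\<theta> (t + real k * T) - \<theta> t)\<bar> \<le> 5 * real k" for k
    proof (induction k)
      case (Suc k)
      then show ?case using step[of "real k * T"] by (auto simp: algebra_simps abs_le_iff)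
    qed simp
    from this[of n] have "\<bar>(\<theta> (s + real n * T) - \<theta> s) - (\<theta> (t + real n * T) - \<theta> t)\<bar> \<le> 5 * real n" .
    moreover have "\<bar>\<theta> (t + real n * T) - \<theta> (real n * T)\<bar> \<le> K * \<bar>t\<bar>" "\<bar>\<theta> t - \<theta> 0\<bar> \<le> K * \<bar>t\<bar>"
      using angle_solution_lipschitz[OF sol K, of "t + real n * T" "real n * T"]
        angle_solution_lipschitz[OF sol K, of t 0] by auto
    moreover have "K * \<bar>t\<bar> \<le> K * B" using B \<open>t \<in> S\<close> \<open>K \<ge> 0\<close> by (intro mult_left_mono) auto
    moreover have "e * (real n * T) = 6 * real n" using \<open>e > 0\<close> by (simp add: T_def)
    ultimately show ?thesis using n by linarith
  qed
  then show ?thesis using that[of "real n * T"] n T by simp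
qed

text \<open>The interval from 0 to \<open>x\<close> is cut into blocks of length \<open>L\<close>
  with nearly equal displacements. The blocks cost at most \<open>e / 2 * x\<close>, the incomplete
  last one at most \<open>2 * K * L\<close>, which is at most \<open>e / 2 * x\<close> for large
  \<open>x\<close>.\<close>

lemma angle_solution_rotation_number:
  assumes sol: "angle_solution a b \<theta>" and pre: "precompact_shifts (\<lambda>x. (a x, b x))"
    and K: "\<And>x. \<bar>a x\<bar> \<le> K" "\<And>x. \<bar>b x\<bar> \<le> K"
  shows "\<exists>\<rho>. ((\<lambda>x. (\<theta> x - \<theta> 0) / x) \<longlongrightarrow> \<rho>) at_top"
proof (rule convergent_filterI)
  fix e :: real assume "e > 0"
  then have "e / 2 > 0" by simp
  from angle_solution_uniform_displacement[OF sol K pre this]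
  obtain L where L: "L > 0" and disp: "\<And>s. \<bar>(\<theta> (s + L) - \<theta> s) - (\<theta> L - \<theta> 0)\<bar> \<le> e / 2 * L" by blast
  have "K \<ge> 0" using K(1)[of 0] by linarith
  have mult: "\<bar>\<theta> (real m * L) - \<theta> 0 - real m * (\<theta> L - \<theta> 0)\<bar> \<le> real m * (e / 2 * L)" for m
  proof (induction m)
    case (Suc m)
    have eq: "real (Suc m) * L = real m * L + L" "real (Suc m) * (\<theta> L - \<theta> 0) = real m * (\<theta> L - \<theta> 0) + (\<theta> L - \<theta> 0)"
      "real (Suc m) * (e / 2 * L) = real m * (e / 2 * L) + e / 2 * L"
      by (simp_all add: algebra_simps)
    show ?case unfolding eq using Suc disp[of "real m * L"] by linarith
  qed simp
  have "\<bar>(\<theta> x - \<theta> 0) / x - (\<theta> L - \<theta> 0) / L\<bar> \<le> e" if x: "x > 0" "4 * K * L \<le> e * x" for x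
  proof -
    define m where "m = nat \<lfloor>x / L\<rfloor>"
    \<comment> \<open>The number of blocks as a real number; comparing first with \<open>m\<close>
      and then with \<open>\<mu>\<close> costs \<open>K * L\<close> each for the fractional
      part.\<close>
    define \<mu> where "\<mu> = x / L"
    have x_eq: "x = \<mu> * L" using L by (simp add: \<mu>_def)
    have m: "real m \<le> \<mu>" "\<mu> < real m + 1" using x L by (auto simp: m_def \<mu>_def)
    have "\<bar>\<theta> x - \<theta> (real m * L)\<bar> \<le> K * \<bar>x - real m * L\<bar>" by (rule angle_solution_lipschitz[OF sol K])
    also have "\<bar>x - real m * L\<bar> = (\<mu> - real m) * L"
      using m L by (simp add: x_eq abs_mult flip: left_diff_distrib)
    also have "K * ((\<mu> - real m) * L) \<le> K * (1 * L)"
      using m L \<open>K \<ge> 0\<close> by (intro mult_left_mono mult_right_mono) auto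
    finally have 1: "\<bar>\<theta> x - \<theta> (real m * L)\<bar> \<le> K * L" by simp
    have "\<bar>\<theta> L - \<theta> 0\<bar> \<le> K * L"
      using angle_solution_lipschitz[OF sol K, of L 0] L by simp
    then have "\<bar>\<mu> - real m\<bar> * \<bar>\<theta> L - \<theta> 0\<bar> \<le> 1 * (K * L)"
      using m by (intro mult_mono) auto
    then have 2: "\<bar>(\<mu> - real m) * (\<theta> L - \<theta> 0)\<bar> \<le> K * L" by (simp add: abs_mult)
    have 3: "real m * (e / 2 * L) \<le> e / 2 * x"
      using mult_right_mono[OF m(1), of "e / 2 * L"] \<open>e > 0\<close> L by (simp add: x_eq algebra_simps)
    have "\<bar>\<theta> x - \<theta> 0 - \<mu> * (\<theta> L - \<theta> 0)\<bar> \<le> e * x"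
    proof -
      have "\<mu> * (\<theta> L - \<theta> 0) = real m * (\<theta> L - \<theta> 0) + (\<mu> - real m) * (\<theta> L - \<theta> 0)"
        by (simp add: algebra_simps)
      then show ?thesis using 1 2 3 mult[of m] x by linarith
    qed
    then have "\<bar>\<theta> x - \<theta> 0 - \<mu> * (\<theta> L - \<theta> 0)\<bar> / x \<le> e" using x by (simp add: field_simps)
    moreover have "(\<theta> x - \<theta> 0) / x - (\<theta> L - \<theta> 0) / L = (\<theta> x - \<theta> 0 - \<mu> * (\<theta> L - \<theta> 0)) / x"
      using x L by (simp add: \<mu>_def field_simps)
    ultimately show ?thesis using x by (simp add: abs_divide)
  qed
  then have "\<forall>\<^sub>F x in at_top. \<bar>(\<theta> x - \<theta> 0) / x - (\<theta> L - \<theta> 0) / L\<bar> \<le> e"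
    using \<open>e > 0\<close>
    by (intro eventually_at_top_linorderI[of "max 1 (4 * K * L / e)"]) (auto simp: field_simps)
  then show "\<exists>c. \<forall>\<^sub>F x in at_top. \<bar>(\<theta> x - \<theta> 0) / x - c\<bar> \<le> e" by blast
qed simp

section \<open>From the Sturm--Liouville equation to the angle equation\<close>

text \<open>Both almost everywhere derivatives agree with continuous functions, so the equation
  becomes a first-order system that holds at every point.\<close>

lemma sl_solution_system:
  assumes sol: "sl_solution p q w lam \<phi>" and p: "\<And>x. p x > 0"
    and cont: "continuous_on UNIV p" "continuous_on UNIV q" "continuous_on UNIV w"
  shows "(\<phi> has_real_derivative 1 / p x * p_deriv p \<phi> x) (at x)"
    and "(p_deriv p \<phi> has_real_derivative - (lam * w x - q x) * \<phi> x) (at x)"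
proof -
  have \<phi>: "locally_abs_cont \<phi>" and u: "locally_abs_cont (p_deriv p \<phi>)"
    and ae: "AE x in lborel. \<phi> differentiable (at x) \<and> p_deriv p \<phi> differentiable (at x) \<and>
        - deriv (p_deriv p \<phi>) x + q x * \<phi> x = lam * w x * \<phi> x"
    using sol unfolding sl_solution_def by auto
  have nz: "p x \<noteq> 0" for x using p[of x] by simp
  have "AE x in lborel. (\<phi> has_real_derivative 1 / p x * p_deriv p \<phi> x) (at x)"
    using ae
  proof eventually_elim
    case (elim x)
    then show ?case
      using nz by (simp add: p_deriv_def DERIV_deriv_iff_real_differentiable)
  qed
  \<comment> \<open>Continuity comes from the absolute continuity of the quasi-derivative, which is
    part of being a solution.\<close>
  moreover have "continuous_on UNIV (\<lambda>x. 1 / p x * p_deriv p \<phi> x)"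
    using cont nz locally_abs_cont_continuous_on[OF u] by (auto intro!: continuous_intros)
  ultimately show "(\<phi> has_real_derivative 1 / p x * p_deriv p \<phi> x) (at x)"
    by (rule locally_abs_cont_has_real_derivative[OF \<phi>])
  have "AE x in lborel. (p_deriv p \<phi> has_real_derivative - (lam * w x - q x) * \<phi> x) (at x)"
    using ae
  proof eventually_elim
    case (elim x)
    then have "deriv (p_deriv p \<phi>) x = - (lam * w x - q x) * \<phi> x" by (simp add: algebra_simps)
    then show ?case using elim by (metis DERIV_deriv_iff_real_differentiable)
  qed
  moreover have "continuous_on UNIV (\<lambda>x. - (lam * w x - q x) * \<phi> x)"
    using cont locally_abs_cont_continuous_on[OF \<phi>] by (auto intro!: continuous_intros)
  ultimately show "(p_deriv p \<phi> has_real_derivative - (lam * w x - q x) * \<phi> x) (at x)"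
    by (rule locally_abs_cont_has_real_derivative[OF u])
qed

text \<open>Gronwall's argument for \<open>\<phi>\<^sup>2 + u\<^sup>2\<close>, whose derivative it dominates up to the factor \<open>2 K\<close>.\<close>

lemma linear_system_zero:
  fixes \<phi> u a b :: "real \<Rightarrow> real"
  assumes \<phi>: "\<And>x. (\<phi> has_real_derivative a x * u x) (at x)"
    and u: "\<And>x. (u has_real_derivative - b x * \<phi> x) (at x)"
    and K: "\<And>x. \<bar>a x\<bar> \<le> K" "\<And>x. \<bar>b x\<bar> \<le> K"
    and zero: "\<phi> x0 = 0" "u x0 = 0"
  shows "\<phi> x = 0"
proof -
  define R where "R x = (\<phi> x)\<^sup>2 + (u x)\<^sup>2" for x
  define R' where "R' x = (a x - b x) * (2 * (\<phi> x * u x))" for x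
  have R: "(R has_real_derivative R' x) (at x)" for x
    unfolding R_def R'_def by (auto intro!: derivative_eq_intros \<phi> u simp: algebra_simps)
  have bound: "\<bar>R' x\<bar> \<le> 2 * K * R x" for x
  proof -
    have "\<bar>R' x\<bar> = \<bar>a x - b x\<bar> * (2 * \<bar>\<phi> x * u x\<bar>)" by (simp add: R'_def abs_mult)
    also have "\<dots> \<le> (2 * K) * R x"
    proof (rule mult_mono)
      show "\<bar>a x - b x\<bar> \<le> 2 * K" using K(1)[of x] K(2)[of x] by linarith
      have "0 \<le> (\<bar>\<phi> x\<bar> - \<bar>u x\<bar>)\<^sup>2" by simp
      then show "2 * \<bar>\<phi> x * u x\<bar> \<le> R x" by (simp add: R_def power2_diff abs_mult)
    qed (use K(1)[of 0] in auto)
    finally show ?thesis .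
  qed
  have "R x \<le> 0"
  \<comment> \<open>To the right of \<open>x0\<close> the weight \<open>exp (- (2 * K * x))\<close>
    makes \<open>R\<close> nonincreasing, to the left \<open>exp (2 * K * x)\<close> makes it
    nondecreasing; both bound it by its zero value at \<open>x0\<close>.\<close>
  proof (cases "x0 \<le> x")
    case True
    then have "R x * exp (- (2 * K * x)) \<le> R x0 * exp (- (2 * K * x0))"
    proof (rule DERIV_nonpos_imp_nonincreasing[where f="\<lambda>x. R x * exp (- (2 * K * x))"])
      fix y
      have "((\<lambda>x. R x * exp (- (2 * K * x))) has_real_derivative (R' y - 2 * K * R y) * exp (- (2 * K * y))) (at y)"
        by (auto intro!: derivative_eq_intros R simp: algebra_simps)
      moreover have "(R' y - 2 * K * R y) * exp (- (2 * K * y)) \<le> 0"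
        using bound[of y] by (intro mult_nonpos_nonneg) auto
      ultimately show "\<exists>z. ((\<lambda>x. R x * exp (- (2 * K * x))) has_real_derivative z) (at y) \<and> z \<le> 0" by blast
    qed
    then show ?thesis using zero by (simp add: R_def[of x0] mult_le_0_iff)
  next
    case False
    then have "x \<le> x0" by simp
    then have "R x * exp (2 * K * x) \<le> R x0 * exp (2 * K * x0)"
    proof (rule DERIV_nonneg_imp_nondecreasing[where f="\<lambda>x. R x * exp (2 * K * x)"])
      fix y
      have "((\<lambda>x. R x * exp (2 * K * x)) has_real_derivative (R' y + 2 * K * R y) * exp (2 * K * y)) (at y)"
        by (auto intro!: derivative_eq_intros R simp: algebra_simps)
      moreover have "(R' y + 2 * K * R y) * exp (2 * K * y) \<ge> 0"
        using bound[of y] by (intro mult_nonneg_nonneg) auto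
      ultimately show "\<exists>z. ((\<lambda>x. R x * exp (2 * K * x)) has_real_derivative z) (at y) \<and> 0 \<le> z" by blast
    qed
    then show ?thesis using zero by (simp add: R_def[of x0] mult_le_0_iff)
  qed
  then show ?thesis by (simp add: R_def sum_power2_le_zero_iff)
qed

text \<open>Near a point \<open>x0\<close> the branch is \<open>\<theta> x0\<close> plus the arcsine of a differentiable function.\<close>

lemma arg_branch_angle_solution:
  fixes \<phi> u a b :: "real \<Rightarrow> real"
  assumes \<phi>: "\<And>x. (\<phi> has_real_derivative a x * u x) (at x)"
    and u: "\<And>x. (u has_real_derivative - b x * \<phi> x) (at x)"
    and nz: "\<And>x. \<phi> x \<noteq> 0 \<or> u x \<noteq> 0"
    and branch: "is_arg_branch (\<lambda>x. Complex (u x) (\<phi> x)) \<theta>"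
  shows "angle_solution a b \<theta>"
  unfolding angle_solution_def
proof
  fix x0
  define r where "r x = sqrt ((u x)\<^sup>2 + (\<phi> x)\<^sup>2)" for x
  have r: "r x > 0" for x using nz[of x] by (auto simp: r_def sum_power2_gt_zero_iff)
  have polar: "u x = r x * cos (\<theta> x)" "\<phi> x = r x * sin (\<theta> x)" for x
  proof -
    have "Complex (u x) (\<phi> x) = complex_of_real (r x) * exp (\<i> * complex_of_real (\<theta> x))"
      using branch unfolding is_arg_branch_def is_Arg_def r_def by (simp add: complex_norm)
    then have "Complex (u x) (\<phi> x) = complex_of_real (r x) * cis (\<theta> x)"
      by (simp add: cis_conv_exp)
    then show "u x = r x * cos (\<theta> x)" "\<phi> x = r x * sin (\<theta> x)"
      by (auto simp: complex_eq_iff)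
  qed
  define c s where "c = cos (\<theta> x0)" and "s = sin (\<theta> x0)"
  \<comment> \<open>The imaginary part of \<open>u + \<i> * \<phi>\<close> rotated by the angle
    \<open>- \<theta> x0\<close>; divided by \<open>r\<close> it is the sine of
    \<open>\<theta> x - \<theta> x0\<close>.\<close>
  define N where "N x = \<phi> x * c - u x * s" for x
  have N: "(N has_real_derivative r x0 * (a x0 * c\<^sup>2 + b x0 * s\<^sup>2)) (at x0)"
    unfolding N_def
    by (rule derivative_eq_intros \<phi> u refl)+ (simp add: polar c_def s_def power2_eq_square algebra_simps)
  have sin: "N x / r x = sin (\<theta> x - \<theta> x0)" for x
    using r[of x] by (simp add: N_def polar c_def s_def sin_diff field_simps)
  have "(u x0)\<^sup>2 + (\<phi> x0)\<^sup>2 > 0" using nz[of x0] by (auto simp: sum_power2_gt_zero_iff)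
  \<comment> \<open>The value of \<open>r'\<close> is irrelevant: it enters the quotient rule
    multiplied by \<open>N x0 = 0\<close>.\<close>
  then have "\<exists>r'. (r has_real_derivative r') (at x0)"
    unfolding r_def by (intro exI) (auto intro!: derivative_eq_intros u \<phi>)
  then obtain r' where r': "(r has_real_derivative r') (at x0)" ..
  have "N x0 = 0" using sin[of x0] r[of x0] by simp
  then have quot: "((\<lambda>x. N x / r x) has_real_derivative a x0 * c\<^sup>2 + b x0 * s\<^sup>2) (at x0)"
    using DERIV_divide[OF N r'] r[of x0] by simp
  have "(arcsin has_real_derivative 1) (at (N x0 / r x0))"
    using DERIV_arcsin[of 0] \<open>N x0 = 0\<close> by simp
  from DERIV_chain2[where f=arcsin, OF this quot]
  have "((\<lambda>x. arcsin (N x / r x)) has_real_derivative a x0 * c\<^sup>2 + b x0 * s\<^sup>2) (at x0)" by simp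
  from DERIV_add[OF this DERIV_const[of "\<theta> x0"]]
  have "((\<lambda>x. arcsin (N x / r x) + \<theta> x0) has_real_derivative a x0 * c\<^sup>2 + b x0 * s\<^sup>2) (at x0)"
    by simp
  then have "(\<theta> has_real_derivative a x0 * c\<^sup>2 + b x0 * s\<^sup>2) (at x0)"
  proof (rule DERIV_cong_ev[THEN iffD1, rotated 3])
    have "isCont \<theta> x0"
      using branch by (simp add: is_arg_branch_def continuous_on_eq_continuous_at)
    then have "(\<theta> \<longlongrightarrow> \<theta> x0) (nhds x0)"
      by (simp add: isCont_def tendsto_at_iff_tendsto_nhds)
    \<comment> \<open>Within \<open>pi / 2\<close> of \<open>\<theta> x0\<close> the arcsine inverts
      the sine, so the continuous branch is recovered exactly.\<close>
    from tendstoD[OF this, of "pi / 2"]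
    have "\<forall>\<^sub>F x in nhds x0. dist (\<theta> x) (\<theta> x0) < pi / 2" by simp
    then show "\<forall>\<^sub>F x in nhds x0. arcsin (N x / r x) + \<theta> x0 = \<theta> x"
    proof eventually_elim
      case (elim x)
      then have "- (pi / 2) \<le> \<theta> x - \<theta> x0" "\<theta> x - \<theta> x0 \<le> pi / 2"
        unfolding dist_real_def by linarith+
      then show ?case by (simp add: sin arcsin_sin)
    qed
  qed auto
  then show "(\<theta> has_real_derivative a x0 * (cos (\<theta> x0))\<^sup>2 + b x0 * (sin (\<theta> x0))\<^sup>2) (at x0)"
    by (simp add: c_def s_def)
qed

section \<open>The rotation number of the Sturm--Liouville equation\<close>

text \<open>Choosing \<open>\<rho>\<close> before \<open>\<phi>\<close> and \<open>\<theta>\<close>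
  expresses independence of the solution and of the branch.\<close>

theorem theorem1p1:
  fixes p q w :: "real \<Rightarrow> real" and lam :: real
  assumes "almost_periodic_pos p" and "almost_periodic_pos w" and "almost_periodic q"
  shows "\<exists>\<rho>::real. \<forall>\<phi> \<theta>.
           sl_solution p q w lam \<phi> \<and> (\<exists>x. \<phi> x \<noteq> 0) \<and>
           is_arg_branch (\<lambda>x. Complex (p_deriv p \<phi> x) (\<phi> x)) \<theta> \<longrightarrow>
           ((\<lambda>x. (\<theta> x - \<theta> 0) / x) \<longlongrightarrow> \<rho>) at_top"
proof -
  have ap: "almost_periodic p" "almost_periodic w" "almost_periodic q"
    using assms by (auto simp: almost_periodic_pos_def)
  then have cont: "continuous_on UNIV p" "continuous_on UNIV q" "continuous_on UNIV w"
    by (auto simp: almost_periodic_def)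
  obtain m where m: "m > 0" "\<And>x. m \<le> p x" using almost_periodic_pos_lower_bound[OF assms(1)] by blast
  have p: "p x > 0" for x using m(1) m(2)[of x] by linarith
  define a b where "a = (\<lambda>x. 1 / p x)" and "b = (\<lambda>x. lam * w x - q x)"
  \<comment> \<open>Since \<open>p \<ge> m\<close>, the reciprocal is Lipschitz on the range with
    constant \<open>1 / m\<^sup>2\<close>.\<close>
  have "uniformly_continuous_on (range p) (\<lambda>y. 1 / y)"
    unfolding uniformly_continuous_on_def
  proof (intro allI impI)
    fix e :: real assume "e > 0"
    have "dist (1 / p y) (1 / p x) < e" if "dist (p y) (p x) < e * m\<^sup>2" for x y
    proof -
      have "dist (1 / p y) (1 / p x) = \<bar>p y - p x\<bar> / (p x * p y)"
        using p[of x] p[of y]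
        by (simp add: dist_real_def divide_simps abs_mult abs_minus_commute)
      also have "\<dots> \<le> \<bar>p y - p x\<bar> / m\<^sup>2"
        using m(1) m(2)[of x] m(2)[of y] p[of x] unfolding power2_eq_square
        by (intro divide_left_mono mult_mono mult_pos_pos p) auto
      also have "\<dots> < e" using that m(1) by (simp add: dist_real_def field_simps)
      finally show ?thesis .
    qed
    then show "\<exists>d>0. \<forall>x\<in>range p. \<forall>y\<in>range p. dist y x < d \<longrightarrow> dist (1 / y) (1 / x) < e"
      using \<open>e > 0\<close> m(1) by (intro exI[of _ "e * m\<^sup>2"]) auto
  qed
  then have "precompact_shifts a"
    unfolding a_def
    by (rule precompact_shifts_compose[OF almost_periodic_imp_precompact_shifts[OF ap(1)]])
  moreover have "precompact_shifts b"
  proof -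
    have "bounded_linear (\<lambda>z::real \<times> real. lam * fst z - snd z)"
      by (intro bounded_linear_sub bounded_linear_const_mult bounded_linear_fst bounded_linear_snd)
    then have "uniformly_continuous_on (range (\<lambda>x. (w x, q x))) (\<lambda>z. lam * fst z - snd z)"
      by (rule bounded_linear.uniformly_continuous_on) (rule uniformly_continuous_on_id)
    from precompact_shifts_compose[OF precompact_shifts_Pair this] show ?thesis
      using ap by (simp add: b_def almost_periodic_imp_precompact_shifts)
  qed
  ultimately have pre: "precompact_shifts (\<lambda>x. (a x, b x))" by (rule precompact_shifts_Pair)
  obtain K where norm: "\<And>x. norm (a x, b x) \<le> K"
    using precompact_shifts_bounded[OF pre] unfolding bounded_iff by auto
  have K: "\<bar>a x\<bar> \<le> K" "\<bar>b x\<bar> \<le> K" for x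
    using norm_fst_le[of "a x" "b x"] norm_snd_le[of "b x" "a x"] norm[of x]
    unfolding real_norm_def by linarith+
  have angle: "angle_solution a b \<theta>"
    if sol: "sl_solution p q w lam \<phi>" and "\<phi> y \<noteq> 0"
      and "is_arg_branch (\<lambda>x. Complex (p_deriv p \<phi> x) (\<phi> x)) \<theta>" for \<phi> \<theta> y
  proof -
    have \<phi>: "(\<phi> has_real_derivative a x * p_deriv p \<phi> x) (at x)"
      and u: "(p_deriv p \<phi> has_real_derivative - b x * \<phi> x) (at x)" for x
      using sl_solution_system[OF sol p cont] by (simp_all add: a_def b_def)
    show ?thesis
      \<comment> \<open>A common zero of \<open>\<phi>\<close> and its quasi-derivative would make
        \<open>\<phi>\<close> vanish everywhere, against \<open>\<phi> y \<noteq> 0\<close>.\<close>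
      using that linear_system_zero[OF \<phi> u K] by (intro arg_branch_angle_solution[OF \<phi> u]) auto
  qed
  show ?thesis
  proof (cases "\<exists>\<theta>. angle_solution a b \<theta>")
    \<comment> \<open>Here no admissible pair \<open>\<phi>\<close>, \<open>\<theta>\<close> exists
      and any \<open>\<rho>\<close> will do.\<close>
    case False
    then show ?thesis using angle by blast
  next
    case True
    then obtain \<theta> where \<theta>: "angle_solution a b \<theta>" by blast
    obtain \<rho> where \<rho>: "((\<lambda>x. (\<theta> x - \<theta> 0) / x) \<longlongrightarrow> \<rho>) at_top"
      using angle_solution_rotation_number[OF \<theta> pre K] by blast
    have "((\<lambda>x. (\<theta>' x - \<theta>' 0) / x) \<longlongrightarrow> \<rho>) at_top" if \<theta>': "angle_solution a b \<theta>'" for \<theta>'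
    proof -
      have "((\<lambda>x. (\<theta>' x - \<theta>' 0) / x - (\<theta> x - \<theta> 0) / x) \<longlongrightarrow> 0) at_top"
      proof (rule Lim_null_comparison)
        show "\<forall>\<^sub>F x in at_top. norm ((\<theta>' x - \<theta>' 0) / x - (\<theta> x - \<theta> 0) / x) \<le> pi / x"
          using eventually_gt_at_top[of 0]
        proof eventually_elim
          case (elim x)
          \<comment> \<open>With equal coefficients \<open>\<delta> = 0\<close>, so the
            displacements differ by at most \<open>pi\<close> at all times.\<close>
          have "\<bar>(\<theta>' x - \<theta>' 0) - (\<theta> x - \<theta> 0)\<bar> \<le> pi + 0 * x * exp (4 * K * x)"
            using elim K by (intro angle_solution_displacement[OF \<theta>' \<theta>]) auto
          then show ?case
            using elim by (simp add: divide_right_mono flip: diff_divide_distrib)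
        qed
        show "((\<lambda>x. pi / x) \<longlongrightarrow> 0) at_top"
          by (intro tendsto_divide_0[OF tendsto_const] filterlim_at_top_imp_at_infinity filterlim_ident)
      qed
      from tendsto_add[OF this \<rho>] show ?thesis by simp
    qed
    then show ?thesis using angle by blast
  qed
qed

end
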